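(* Suppose that the matrices $P(t)$ are given by $P(t)=P(G(t))$, where $G'\mapsto P(G')$ is a map assigning to each spanning subgraph $G'=(V,E')\in\mathcal{S}(G)$ a real $n\times n$ matrix $P(G')=(p_{ij}(G'))$ such that: (i) $p_{ij}(G')\in[0,1]$ for all $i,j\in V$, $\sum_{j=1}^n p_{ij}(G')=1$ for all $i\in V$, and $p_{ij}(G')\ne 0$ if and only if $j=i$ or $(i,j)\in E'$; (ii) $P(G')$ is invertible. Then for almost all (with respect to Lebesgue measure on $\mathbb{R}^n$) vectors of initial opinions $x^0\in\mathbb{R}^n$, the following holds: if the trajectory starting from $x^0$ satisfies the fast convergence assumption, then for all communities $C\in\mathscr{C}$ with $|C|\ge 2$, $$|\lambda_2(P_C(G_{\mathscr{C}}))|<\rho .$$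
   Context: Opinion dynamics with decaying confidence. Let $V=\{1,\dots,n\}$ be a finite set of agents and $E\subseteq V\times V$ a symmetric, anti-reflexive relation, so that $G=(V,E)$ is an undirected graph. $\mathcal{S}(G)$ denotes the (finite) set of spanning subgraphs $G'=(V,E')$ of $G$, with $E'\subseteq E$ symmetric. Let $R>0$ and $\rho\in(0,1)$ be parameters. Given a vector of initial opinions $x^0\in\mathbb{R}^n$, the vector of opinions $x(t)=(x_1(t),\dots,x_n(t))^\top$, $t\in\mathbb{N}=\{0,1,2,\dots\}$, is defined by $x(0)=x^0$ and $$x(t+1)=P(t)x(t),\qquad P(t)=P(G(t)),$$ where $G(t)=(V,E(t))$ is the interaction graph at time $t$, with $$E(t)=\{(i,j)\in E\mid |x_i(t)-x_j(t)|\le R\rho^t\}.$$ Under condition (i), each sequence $(x_i(t))_{t\in\mathbb{N}}$ converges; its limit is denoted $x_i^*$. Fast convergence assumption (for a trajectory): there exist $\underline{\rho}<\rho$ and $M\ge 0$ such that for all $i\in V$ and all $t\in\mathbb{N}$, $|x_i(t)-x_i^*|\le M\underline{\rho}^t$. Agents $i,j$ asymptotically agree, written $i\sim^* j$, if $x_i^*=x_j^*$; this is an equivalence relation on $V$. Communities are the equivalence classes, and $\mathscr{C}=V/\!\sim^*$ is the set of communities (depending on $x^0$). The graph of communities is $G_{\mathscr{C}}=(V,E_{\mathscr{C}})\in\mathcal{S}(G)$ with $E_{\mathscr{C}}=\{(i,j)\in E\mid i\sim^* j\}$. For $I\subseteq V$ and $G'\in\mathcal{S}(G)$, $P_I(G')$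 is the $|I|\times|I|$ submatrix of $P(G')$ with rows and columns indexed by $I$. If no agent of $I$ is connected in $G'$ to an agent of $V\setminus I$ (as is the case for $I=C\in\mathscr{C}$, $G'=G_{\mathscr{C}}$), then $P_I(G')$ is row stochastic, and its (complex) eigenvalues, counted with algebraic multiplicity, are denoted $\lambda_1(P_I(G')),\dots,\lambda_{|I|}(P_I(G'))$, ordered so that $\lambda_1(P_I(G'))=1$ and $|\lambda_1(P_I(G'))|\ge|\lambda_2(P_I(G'))|\ge\dots\ge|\lambda_{|I|}(P_I(G'))|$. *)

theory Defs
  imports "HOL-Analysis.Analysis" "Jordan_Normal_Form.Char_Poly"
begin

no_notation Matrix.vec_index (infixl \<open>$\<close> 100)

definition spanning_subgraphs :: "'n rel \<Rightarrow> 'n rel set" where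
  "spanning_subgraphs E = {E'. E' \<subseteq> E \<and> sym E'}"

definition interaction_edges ::
    "'n rel \<Rightarrow> real \<Rightarrow> real \<Rightarrow> nat \<Rightarrow> real ^ 'n \<Rightarrow> ('n :: finite) rel" where
  "interaction_edges E R \<rho> t y = {(i, j) \<in> E. \<bar>y $ i - y $ j\<bar> \<le> R * \<rho> ^ t}"

primrec opinions ::
    "('n rel \<Rightarrow> real ^ 'n ^ 'n) \<Rightarrow> 'n rel \<Rightarrow> real \<Rightarrow> real \<Rightarrow> real ^ 'n \<Rightarrow> nat \<Rightarrow> real ^ ('n :: finite)" where
  "opinions P E R \<rho> x0 0 = x0"
| "opinions P E R \<rho> x0 (Suc t) =
     P (interaction_edges E R \<rho> t (opinions P E R \<rho> x0 t)) *v opinions P E R \<rho> x0 t"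

definition limit_opinion ::
    "('n rel \<Rightarrow> real ^ 'n ^ 'n) \<Rightarrow> 'n rel \<Rightarrow> real \<Rightarrow> real \<Rightarrow> real ^ 'n \<Rightarrow> 'n :: finite \<Rightarrow> real" where
  "limit_opinion P E R \<rho> x0 i = lim (\<lambda>t. opinions P E R \<rho> x0 t $ i)"

definition fast_convergence ::
    "('n rel \<Rightarrow> real ^ 'n ^ 'n) \<Rightarrow> 'n rel \<Rightarrow> real \<Rightarrow> real \<Rightarrow> real ^ ('n :: finite) \<Rightarrow> bool" where
  "fast_convergence P E R \<rho> x0 \<longleftrightarrow>
     (\<exists>\<rho>' M. \<rho>' < \<rho> \<and> M \<ge> 0 \<and>
        (\<forall>i t. \<bar>opinions P E R \<rho> x0 t $ i - limit_opinion P E R \<rho> x0 i\<bar> \<le> M * \<rho>' ^ t))"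

definition asymptotic_agreement ::
    "('n rel \<Rightarrow> real ^ 'n ^ 'n) \<Rightarrow> 'n rel \<Rightarrow> real \<Rightarrow> real \<Rightarrow> real ^ 'n \<Rightarrow> ('n :: finite) rel" where
  "asymptotic_agreement P E R \<rho> x0 =
     {(i, j). limit_opinion P E R \<rho> x0 i = limit_opinion P E R \<rho> x0 j}"

definition communities ::
    "('n rel \<Rightarrow> real ^ 'n ^ 'n) \<Rightarrow> 'n rel \<Rightarrow> real \<Rightarrow> real \<Rightarrow> real ^ 'n \<Rightarrow> ('n :: finite) set set" where
  "communities P E R \<rho> x0 = UNIV // asymptotic_agreement P E R \<rho> x0"

definition community_edges ::
    "('n rel \<Rightarrow> real ^ 'n ^ 'n) \<Rightarrow> 'n rel \<Rightarrow> real \<Rightarrow> real \<Rightarrow> real ^ 'n \<Rightarrow> ('n :: finite) rel" where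
  "community_edges P E R \<rho> x0 = E \<inter> asymptotic_agreement P E R \<rho> x0"

(* The elements of I are listed by an arbitrary bijection from {..<card I} onto I, the same for
   rows and columns; another listing gives a permutation-similar matrix with the same
   characteristic polynomial. *)
definition principal_submatrix ::
    "real ^ 'n ^ 'n \<Rightarrow> ('n :: finite) set \<Rightarrow> real mat" where
  "principal_submatrix A I =
     Matrix.mat (card I) (card I)
       (\<lambda>(a, b). A $ (from_nat_into I a) $ (from_nat_into I b))"

(* All complex eigenvalues, repeated according to their multiplicity in the characteristic
   polynomial, by decreasing modulus and starting with 1.  The last condition selects 1 among
   the eigenvalues of modulus 1 of a row stochastic matrix. *)
definition ordered_eigenvalues :: "real mat \<Rightarrow> complex list \<Rightarrow> bool" where
  "ordered_eigenvalues A ls \<longleftrightarrow>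
     char_poly (map_mat complex_of_real A) = (\<Prod>l\<leftarrow>ls. [:- l, 1:]) \<and>
     sorted_wrt (\<lambda>k l. cmod k \<ge> cmod l) ls \<and>
     ls \<noteq> [] \<and> hd ls = 1"

(* Only meaningful for nonempty row stochastic matrices, where such a list exists (see below);
   different choices of the list agree on the moduli. *)
definition eigenvalue_nr :: "nat \<Rightarrow> real mat \<Rightarrow> complex" where
  "eigenvalue_nr k A = (SOME ls. ordered_eigenvalues A ls) ! (k - 1)"

lemma row_stochastic_eigenvalue_bound:
  fixes A :: "real mat"
  assumes A: "A \<in> carrier_mat n n"
    and nonneg: "\<And>i j. i < n \<Longrightarrow> j < n \<Longrightarrow> A $$ (i, j) \<ge> 0"
    and stoch: "\<And>i. i < n \<Longrightarrow> (\<Sum>j<n. A $$ (i, j)) = 1"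
    and ev: "eigenvalue (map_mat complex_of_real A) l"
  shows "cmod l \<le> 1"
proof -
  obtain v where v: "v \<in> carrier_vec n" "v \<noteq> 0\<^sub>v n"
    "map_mat complex_of_real A *\<^sub>v v = l \<cdot>\<^sub>v v"
    using ev A unfolding eigenvalue_def eigenvector_def by auto
  obtain i0 where i0: "i0 < n" "vec_index v i0 \<noteq> 0"
    using v(1,2) by (metis carrier_vecD eq_vecI index_zero_vec)
  define m where "m = Max ((\<lambda>i. cmod (vec_index v i)) ` {..<n})"
  have le: "cmod (vec_index v i) \<le> m" if "i < n" for i
    unfolding m_def using that by (intro Max_ge) auto
  have m0: "m > 0" using le[OF i0(1)] i0(2) by (smt (verit) zero_less_norm_iff)
  have "m \<in> (\<lambda>i. cmod (vec_index v i)) ` {..<n}"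
    unfolding m_def using i0(1) by (intro Max_in) auto
  then obtain i where i: "i < n" "cmod (vec_index v i) = m" by auto
  have "l * vec_index v i = vec_index (map_mat complex_of_real A *\<^sub>v v) i"
    using v i by simp
  also have "\<dots> = (\<Sum>j<n. complex_of_real (A $$ (i, j)) * vec_index v j)"
    using A v(1) i by (auto simp: scalar_prod_def atLeast0LessThan intro!: sum.cong)
  finally have "cmod l * m = cmod (\<Sum>j<n. complex_of_real (A $$ (i, j)) * vec_index v j)"
    using i by (metis norm_mult)
  also have "\<dots> \<le> (\<Sum>j<n. A $$ (i, j) * m)"
    using le nonneg i by (intro sum_norm_le) (auto simp: norm_mult intro!: mult_left_mono)
  also have "\<dots> = 1 * m" using stoch[OF i(1)] by (simp flip: sum_distrib_right)
  finally show ?thesis using m0 by simp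
qed

lemma ordered_eigenvalues_exist:
  fixes A :: "real mat"
  assumes A: "A \<in> carrier_mat n n" and n: "n > 0"
    and nonneg: "\<And>i j. i < n \<Longrightarrow> j < n \<Longrightarrow> A $$ (i, j) \<ge> 0"
    and stoch: "\<And>i. i < n \<Longrightarrow> (\<Sum>j<n. A $$ (i, j)) = 1"
  shows "\<exists>ls. ordered_eigenvalues A ls"
proof -
  let ?C = "map_mat complex_of_real A"
  have C: "?C \<in> carrier_mat n n" using A by simp
  obtain as where as: "char_poly ?C = (\<Prod>a\<leftarrow>as. [:- a, 1:])"
    using char_poly_factorized[OF C] by auto
  have root: "eigenvalue ?C a \<longleftrightarrow> a \<in> set as" for a
    by (simp add: eigenvalue_root_char_poly[OF C] as poly_prod_list o_def
        prod_list_zero_iff image_iff)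
  have "eigenvector ?C (Matrix.vec n (\<lambda>_. 1)) 1"
    unfolding eigenvector_def
  proof (intro conjI)
    show "Matrix.vec n (\<lambda>_. 1 :: complex) \<noteq> 0\<^sub>v (dim_row ?C)"
      using A n by (auto simp: vec_eq_iff)
    show "?C *\<^sub>v Matrix.vec n (\<lambda>_. 1) = 1 \<cdot>\<^sub>v Matrix.vec n (\<lambda>_. 1)"
    proof (rule eq_vecI)
      fix i assume "i < dim_vec (1 \<cdot>\<^sub>v Matrix.vec n (\<lambda>_. 1 :: complex))"
      then have i: "i < n" by simp
      have "(\<Sum>j<n. complex_of_real (A $$ (i, j))) = 1"
        using stoch[OF i] by (metis of_real_1 of_real_sum)
      then show "vec_index (?C *\<^sub>v Matrix.vec n (\<lambda>_. 1)) i
          = vec_index (1 \<cdot>\<^sub>v Matrix.vec n (\<lambda>_. 1)) i"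
        using A i by (simp add: scalar_prod_def atLeast0LessThan)
    qed (use A in auto)
  qed (use A in auto)
  then have one: "1 \<in> set as" using root unfolding eigenvalue_def by blast
  define ls where "ls = 1 # sort_key (\<lambda>a. - cmod a) (remove1 1 as)"
  have ms: "mset ls = mset as" using one by (simp add: ls_def)
  have "char_poly ?C = (\<Prod>a\<leftarrow>ls. [:- a, 1:])"
    using as ms by (metis mset_map prod_mset_prod_list)
  moreover have "sorted_wrt (\<lambda>k l. cmod k \<ge> cmod l) ls"
  proof -
    have "sorted (map (\<lambda>a. - cmod a) (sort_key (\<lambda>a. - cmod a) (remove1 1 as)))" by simp
    moreover have "cmod a \<le> 1" if "a \<in> set as" for a
      using row_stochastic_eigenvalue_bound[OF A nonneg stoch] root that by blast
    ultimately show ?thesis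
      unfolding ls_def by (auto simp: sorted_map dest: notin_set_remove1 in_set_remove1 set_remove1_subset[THEN subsetD])
  qed
  ultimately have "ordered_eigenvalues A ls"
    unfolding ordered_eigenvalues_def by (simp add: ls_def)
  then show ?thesis ..
qed

end

theory Submission
  imports Defs
begin

text \<open>
  The key observation is that fast convergence is a linear condition on the opinions, as soon
  as the interaction graph has stopped changing.

  On a fast trajectory the graph does stop changing. Opinions approach their limits faster than
  the confidence bound \<open>R * \<rho> ^ t\<close> shrinks, so an edge inside a community is eventually present,
  and an edge between two communities is eventually absent because the bound tends to \<open>0\<close>
  (\<open>eventually_community_edges\<close>). From some time \<open>T\<close> on, the trajectory is therefore the orbit of
  \<open>x(T)\<close> under the single matrix \<open>A = P(G)\<close>, where \<open>G\<close> is the graph of communities.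

  Let \<open>C\<close> be a community and let \<open>l\<close> be the second eigenvalue of its block of \<open>A\<close>. This block is
  row stochastic, and there is a left eigenvector \<open>w\<close> for \<open>l\<close> whose entries sum to \<open>0\<close>
  (\<open>second_eigenvalue_left_eigenvector\<close>). On an orbit the functional \<open>w\<close> is multiplied by \<open>l\<close> in
  every step, while it ignores the common limit of the opinions in \<open>C\<close>; so its value decays at
  least as fast as the opinions converge. If \<open>cmod l \<ge> \<rho>\<close>, both can hold only if \<open>w\<close> vanishes at
  \<open>x(T)\<close> (\<open>fast_decay_annihilates\<close>), which confines \<open>x(T)\<close> to a hyperplane that depends on \<open>G\<close>
  and \<open>C\<close> only.

  Finally \<open>x(T)\<close> arises from \<open>x(0)\<close> by a product of matrices \<open>P(G')\<close>. The product is invertible, so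
  the hyperplane pulls back to a hyperplane of initial opinions, which is a null set. A product
  is given by a finite list of graphs, hence only countably many null sets occur, and outside
  their union no fast trajectory has a community with \<open>cmod l \<ge> \<rho>\<close>.
\<close>

section \<open>Splitting off the trivial eigenvalue of a matrix with constant row sums\<close>

text \<open>
  The all-ones vector is an eigenvector for \<open>r\<close>, and the remaining factor is the characteristic
  polynomial of the map induced on the quotient by that vector. The differences \<open>y\<^sub>i - y\<^sub>0\<close> are
  coordinates on the quotient. Passing to the basis in which the all-ones vector replaces the
  first unit vector makes \<open>A\<close> block triangular.
\<close>

lemma char_poly_const_row_sums:
  fixes A :: "'a :: field mat"
  assumes A: "A \<in> carrier_mat (Suc m) (Suc m)"
    and sums: "\<And>i. i < Suc m \<Longrightarrow> (\<Sum>j<Suc m. A $$ (i, j)) = r"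
  shows "char_poly A =
    [:- r, 1:] * char_poly (Matrix.mat m m (\<lambda>(i, j). A $$ (Suc i, Suc j) - A $$ (0, Suc j)))"
proof -
  define D where "D = Matrix.mat m m (\<lambda>(i, j). A $$ (Suc i, Suc j) - A $$ (0, Suc j))"
  \<comment> \<open>\<open>S\<close> maps \<open>y\<close> to \<open>y\<^sub>0\<close> and the differences \<open>y\<^sub>i - y\<^sub>0\<close>; \<open>T\<close> is its inverse.\<close>
  define S :: "'a mat" where "S = Matrix.mat (Suc m) (Suc m)
    (\<lambda>(i, j). if i = j then 1 else if j = 0 then - 1 else 0)"
  define T :: "'a mat" where "T = Matrix.mat (Suc m) (Suc m)
    (\<lambda>(i, j). if i = j \<or> j = 0 then 1 else 0)"
  have S: "S \<in> carrier_mat (Suc m) (Suc m)" and T: "T \<in> carrier_mat (Suc m) (Suc m)"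
    by (simp_all add: S_def T_def)
  have S_mult: "(S * M) $$ (i, j) = M $$ (i, j) - (if i = 0 then 0 else M $$ (0, j))"
    if M: "M \<in> carrier_mat (Suc m) (Suc m)" and ij: "i < Suc m" "j < Suc m" for M i j
  proof -
    have "(S * M) $$ (i, j) = (\<Sum>k<Suc m. S $$ (i, k) * M $$ (k, j))"
      using S M ij by (simp add: scalar_prod_def atLeast0LessThan del: sum.lessThan_Suc)
    also have "\<dots> = (\<Sum>k<Suc m. (if k = i then M $$ (i, j) else 0)
        - (if k = 0 then (if i = 0 then 0 else M $$ (0, j)) else 0))"
      using ij by (intro sum.cong) (auto simp: S_def)
    also have "\<dots> = M $$ (i, j) - (if i = 0 then 0 else M $$ (0, j))"
      using ij by (simp add: sum_subtractf del: sum.lessThan_Suc)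
    finally show ?thesis .
  qed
  have mult_T: "(M * T) $$ (i, j) = (if j = 0 then \<Sum>k<Suc m. M $$ (i, k) else M $$ (i, j))"
    if M: "M \<in> carrier_mat (Suc m) (Suc m)" and ij: "i < Suc m" "j < Suc m" for M i j
  proof -
    have "(M * T) $$ (i, j) = (\<Sum>k<Suc m. M $$ (i, k) * T $$ (k, j))"
      using T M ij by (simp add: scalar_prod_def atLeast0LessThan del: sum.lessThan_Suc)
    also have "\<dots> = (\<Sum>k<Suc m. if j = 0 then M $$ (i, k) else if k = j then M $$ (i, j) else 0)"
      using ij by (intro sum.cong) (auto simp: T_def)
    also have "\<dots> = (if j = 0 then \<Sum>k<Suc m. M $$ (i, k) else M $$ (i, j))"
      using ij by (simp del: sum.lessThan_Suc)
    finally show ?thesis .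
  qed
  have ST: "S * T = 1\<^sub>m (Suc m)"
  proof (rule eq_matI)
    fix i j assume "i < dim_row (1\<^sub>m (Suc m) :: 'a mat)" "j < dim_col (1\<^sub>m (Suc m) :: 'a mat)"
    then show "(S * T) $$ (i, j) = 1\<^sub>m (Suc m) $$ (i, j)"
      using S_mult[OF T, of i j] by (auto simp: T_def)
  qed (use S T in auto)
  then have TS: "T * S = 1\<^sub>m (Suc m)"
    using mat_mult_left_right_inverse[OF S T] by simp
  define B where "B = S * A * T"
  have B: "B \<in> carrier_mat (Suc m) (Suc m)" using S A T by (simp add: B_def)
  have "T * B * S = (T * S) * A * (T * S)"
    unfolding B_def using S A T by (simp add: assoc_mult_mat[of _ "Suc m" "Suc m" _ "Suc m" _ "Suc m"])
  then have "similar_mat A B"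
    using A B S T ST TS by (intro similar_matI[of A B T S "Suc m"]) auto
  then have "char_poly A = char_poly B" by (rule char_poly_similar)
  also have "B = four_block_mat (Matrix.mat 1 1 (\<lambda>_. r)) (Matrix.mat 1 m (\<lambda>(i, j). A $$ (0, Suc j)))
      (0\<^sub>m m 1) D" (is "_ = ?F")
  proof (rule eq_matI)
    fix i j assume "i < dim_row ?F" "j < dim_col ?F"
    then have ij: "i < Suc m" "j < Suc m" by (auto simp: D_def)
    have SA: "S * A \<in> carrier_mat (Suc m) (Suc m)" using S A by simp
    have row: "(\<Sum>k<Suc m. (S * A) $$ (i, k)) = (if i = 0 then r else 0)"
    proof -
      have "(\<Sum>k<Suc m. (S * A) $$ (i, k))
          = (\<Sum>k<Suc m. A $$ (i, k) - (if i = 0 then 0 else A $$ (0, k)))"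
        using ij by (intro sum.cong) (auto simp: S_mult[OF A])
      then show ?thesis using sums[OF ij(1)] sums[of 0] by (simp add: sum_subtractf del: sum.lessThan_Suc)
    qed
    show "B $$ (i, j) = ?F $$ (i, j)"
      using ij unfolding B_def mult_T[OF SA ij] row
      by (cases i; cases j) (auto simp: S_mult[OF A] D_def)
  qed (use B in \<open>auto simp: D_def\<close>)
  also have "char_poly \<dots> = char_poly (Matrix.mat 1 1 (\<lambda>_. r)) * char_poly D"
    by (rule char_poly_four_block_zeros_col) (auto simp: D_def)
  also have "char_poly (Matrix.mat 1 1 (\<lambda>_. r)) = [:- r, 1:]"
    by (simp add: char_poly_defs det_def permutes_sing)
  finally show ?thesis unfolding D_def .
qed

text \<open>
  Left eigenvectors whose entries sum to \<open>0\<close> are the functionals on the quotient by the all-ones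
  vector, so they see exactly the eigenvalues other than one copy of \<open>r\<close>. The point of arguing
  on the quotient is that the case \<open>l = r\<close> is covered: if \<open>r\<close> is a multiple root, some left
  eigenvector for \<open>r\<close> has sum \<open>0\<close>, whether or not \<open>A\<close> is diagonalizable.
\<close>

lemma left_eigenvector_sum_zero:
  fixes A :: "'a :: field mat"
  assumes A: "A \<in> carrier_mat (Suc m) (Suc m)"
    and sums: "\<And>i. i < Suc m \<Longrightarrow> (\<Sum>j<Suc m. A $$ (i, j)) = r"
    and cp: "char_poly A = [:- r, 1:] * p" and root: "poly p l = 0"
  shows "\<exists>w. (\<exists>i<Suc m. w i \<noteq> 0) \<and> (\<Sum>i<Suc m. w i) = 0 \<and>
    (\<forall>j<Suc m. (\<Sum>i<Suc m. w i * A $$ (i, j)) = l * w j)"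
proof -
  define D where "D = Matrix.mat m m (\<lambda>(i, j). A $$ (Suc i, Suc j) - A $$ (0, Suc j))"
  have D: "D \<in> carrier_mat m m" by (simp add: D_def)
  have "[:- r, 1:] * p = [:- r, 1:] * char_poly D"
    using char_poly_const_row_sums[OF A sums] cp by (simp add: D_def)
  then have p: "p = char_poly D" by (subst (asm) mult_cancel_left) auto
  have DT: "transpose_mat D \<in> carrier_mat m m" using D by simp
  have "eigenvalue (transpose_mat D) l"
    using eigenvalue_root_char_poly[OF DT] root D by (simp add: p)
  then obtain u where u: "u \<in> carrier_vec m" "u \<noteq> 0\<^sub>v m" "transpose_mat D *\<^sub>v u = l \<cdot>\<^sub>v u"
    using D unfolding eigenvalue_def eigenvector_def by auto
  \<comment> \<open>The first entry is forced by the vanishing sum.\<close>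
  define w where "w = case_nat (- (\<Sum>i<m. vec_index u i)) (vec_index u)"
  have sum0: "(\<Sum>i<Suc m. w i) = 0"
    by (simp only: sum.lessThan_Suc_shift) (simp add: w_def)
  have eig: "(\<Sum>i<Suc m. w i * A $$ (i, Suc j)) = l * w (Suc j)" if "j < m" for j
  proof -
    have "l * w (Suc j) = vec_index (transpose_mat D *\<^sub>v u) j"
      using u that by (simp add: w_def)
    also have "\<dots> = (\<Sum>i<m. (A $$ (Suc i, Suc j) - A $$ (0, Suc j)) * vec_index u i)"
      using u(1) that D by (auto simp: scalar_prod_def atLeast0LessThan D_def intro!: sum.cong)
    also have "\<dots> = (\<Sum>i<Suc m. w i * A $$ (i, Suc j))"
      by (simp only: sum.lessThan_Suc_shift)
        (simp add: w_def algebra_simps sum_subtractf sum_distrib_right)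
    finally show ?thesis ..
  qed
  \<comment> \<open>Column \<open>0\<close> follows from the others, since the row sums give the total over all columns.\<close>
  have "(\<Sum>j<Suc m. \<Sum>i<Suc m. w i * A $$ (i, j)) = (\<Sum>i<Suc m. w i * r)"
    by (subst sum.swap) (simp add: sums flip: sum_distrib_left del: sum.lessThan_Suc)
  also have "\<dots> = 0" using sum0 by (simp flip: sum_distrib_right del: sum.lessThan_Suc)
  finally have "(\<Sum>i<Suc m. w i * A $$ (i, 0)) = - (\<Sum>j<m. l * w (Suc j))"
    using eig by (subst (asm) sum.lessThan_Suc_shift) (simp add: add_eq_0_iff2 del: sum.lessThan_Suc)
  also have "\<dots> = l * w 0"
    by (simp add: w_def sum_distrib_left)
  finally have eig0: "(\<Sum>i<Suc m. w i * A $$ (i, 0)) = l * w 0" .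
  obtain k where "k < m" "vec_index u k \<noteq> 0"
    using u(1,2) by (metis carrier_vecD eq_vecI index_zero_vec)
  then have "\<exists>i<Suc m. w i \<noteq> 0" by (intro exI[of _ "Suc k"]) (simp add: w_def)
  moreover have "(\<Sum>i<Suc m. w i * A $$ (i, j)) = l * w j" if "j < Suc m" for j
    using that eig0 eig by (cases j) (auto simp del: sum.lessThan_Suc)
  ultimately show ?thesis using sum0 by blast
qed

text \<open>
  No entry of \<open>A\<close> leads out of \<open>C\<close>, so a left eigenvector of the block, extended by \<open>0\<close>, is a left
  eigenvector of the whole matrix.
\<close>

lemma second_eigenvalue_left_eigenvector:
  fixes A :: "real ^ 'n ^ 'n" and C :: "('n :: finite) set"
  assumes nonneg: "\<And>i j. 0 \<le> A $ i $ j" and stoch: "\<And>i. (\<Sum>j\<in>UNIV. A $ i $ j) = 1"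
    and closed: "\<And>i j. i \<in> C \<Longrightarrow> j \<notin> C \<Longrightarrow> A $ i $ j = 0"
    and card: "card C \<ge> 2"
  shows "\<exists>w :: 'n \<Rightarrow> complex. (\<exists>i. w i \<noteq> 0) \<and> (\<forall>i. i \<notin> C \<longrightarrow> w i = 0) \<and> (\<Sum>i\<in>UNIV. w i) = 0 \<and>
    (\<forall>j. (\<Sum>i\<in>UNIV. w i * of_real (A $ i $ j))
           = eigenvalue_nr 2 (principal_submatrix A C) * w j)"
proof -
  define B where "B = principal_submatrix A C"
  define l where "l = eigenvalue_nr 2 B"
  let ?B = "map_mat complex_of_real B"
  obtain m where m: "card C = Suc m" using card by (cases "card C") auto
  have B: "B \<in> carrier_mat (Suc m) (Suc m)" by (simp add: B_def principal_submatrix_def m)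
  have B_index: "B $$ (a, b) = A $ from_nat_into C a $ from_nat_into C b" if "a < Suc m" "b < Suc m" for a b
    using that by (simp add: B_def principal_submatrix_def m)
  have bij: "bij_betw (from_nat_into C) {..<Suc m} C"
    using bij_betw_from_nat_into_finite[of C] m by simp
  have C_in: "from_nat_into C a \<in> C" if "a < Suc m" for a
    using bij that by (auto simp: bij_betw_def)
  have sumC: "(\<Sum>a<Suc m. f (from_nat_into C a)) = (\<Sum>i\<in>C. f i)" for f :: "'n \<Rightarrow> 'b :: comm_monoid_add"
    using sum.reindex_bij_betw[OF bij] .
  have B_stoch: "(\<Sum>b<Suc m. B $$ (a, b)) = 1" if "a < Suc m" for a
  proof -
    have "(\<Sum>b<Suc m. B $$ (a, b)) = (\<Sum>b<Suc m. A $ from_nat_into C a $ from_nat_into C b)"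
      using that by (intro sum.cong) (auto simp: B_index)
    also have "\<dots> = (\<Sum>j\<in>C. A $ from_nat_into C a $ j)" by (rule sumC)
    also have "\<dots> = (\<Sum>j\<in>UNIV. A $ from_nat_into C a $ j)"
      using closed[OF C_in[OF that]] by (intro sum.mono_neutral_left) auto
    finally show ?thesis using stoch by simp
  qed
  define ls where "ls = (SOME ls. ordered_eigenvalues B ls)"
  have "ordered_eigenvalues B ls"
    unfolding ls_def
  proof (rule someI_ex[OF ordered_eigenvalues_exist[OF B]])
    show "B $$ (i, j) \<ge> 0" if "i < Suc m" "j < Suc m" for i j
      using that nonneg by (simp add: B_index)
  qed (use B_stoch in auto)
  then have cp: "char_poly ?B = (\<Prod>l\<leftarrow>ls. [:- l, 1:])" and ne: "ls \<noteq> []" "hd ls = 1"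
    by (auto simp: ordered_eigenvalues_def)
  have CB: "?B \<in> carrier_mat (Suc m) (Suc m)" using B by simp
  have "degree (char_poly ?B) = length ls"
    unfolding cp by (rule degree_linear_factors)
  then have len: "length ls = Suc m" using degree_monic_char_poly[OF CB] by simp
  obtain ks where ks: "ls = 1 # ks" using ne by (cases ls) auto
  have "m \<ge> 1" using card m by simp
  \<comment> \<open>Removing the leading \<open>1\<close> leaves the list that starts with the second eigenvalue.\<close>
  then have "l \<in> set ks"
    using len by (auto simp: l_def eigenvalue_nr_def ks simp flip: ls_def)
  then have root: "poly (\<Prod>l\<leftarrow>ks. [:- l, 1:]) l = 0"
    by (auto simp: poly_prod_list prod_list_zero_iff image_iff)
  have CB_stoch: "(\<Sum>b<Suc m. ?B $$ (a, b)) = 1" if "a < Suc m" for a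
  proof -
    have "(\<Sum>b<Suc m. ?B $$ (a, b)) = (\<Sum>b<Suc m. of_real (B $$ (a, b)))"
      using B that by (intro sum.cong) auto
    then show ?thesis using B_stoch[OF that] by (simp flip: of_real_sum del: sum.lessThan_Suc)
  qed
  have cp': "char_poly ?B = [:- 1, 1:] * (\<Prod>l\<leftarrow>ks. [:- l, 1:])" by (simp add: cp ks)
  obtain v where v: "\<exists>a<Suc m. v a \<noteq> 0" "(\<Sum>a<Suc m. v a) = 0"
    "\<And>b. b < Suc m \<Longrightarrow> (\<Sum>a<Suc m. v a * ?B $$ (a, b)) = l * v b"
    using left_eigenvector_sum_zero[OF CB CB_stoch cp' root] by blast
  define g where "g = inv_into {..<Suc m} (from_nat_into C)"
  have g: "g (from_nat_into C a) = a" if "a < Suc m" for a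
    using that bij unfolding g_def by (intro inv_into_f_f) (auto simp: bij_betw_def)
  define w where "w i = (if i \<in> C then v (g i) else 0)" for i
  have w: "w (from_nat_into C a) = v a" if "a < Suc m" for a
    using that C_in g by (simp add: w_def)
  have sum_w: "(\<Sum>i\<in>UNIV. w i * f i) = (\<Sum>a<Suc m. v a * f (from_nat_into C a))" for f
  proof -
    have "(\<Sum>i\<in>UNIV. w i * f i) = (\<Sum>i\<in>C. w i * f i)"
      by (intro sum.mono_neutral_right) (auto simp: w_def)
    also have "\<dots> = (\<Sum>a<Suc m. w (from_nat_into C a) * f (from_nat_into C a))" by (rule sumC[symmetric])
    also have "\<dots> = (\<Sum>a<Suc m. v a * f (from_nat_into C a))"
      by (intro sum.cong) (auto simp: w)
    finally show ?thesis .
  qed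
  show ?thesis
  proof (intro exI[of _ w] conjI allI impI)
    show "\<exists>i. w i \<noteq> 0" using v(1) w by metis
    show "(\<Sum>i\<in>UNIV. w i) = 0" using sum_w[of "\<lambda>_. 1"] v(2) by simp
    show "(\<Sum>i\<in>UNIV. w i * of_real (A $ i $ j))
           = eigenvalue_nr 2 (principal_submatrix A C) * w j" for j
    proof (cases "j \<in> C")
      case True
      then obtain b where b: "b < Suc m" "j = from_nat_into C b"
        using bij by (auto simp: bij_betw_def)
      have "(\<Sum>i\<in>UNIV. w i * of_real (A $ i $ j)) = (\<Sum>a<Suc m. v a * ?B $$ (a, b))"
        unfolding sum_w using B b by (intro sum.cong) (auto simp: B_index)
      then show ?thesis using v(3)[OF b(1)] w[OF b(1)] b(2) by (simp add: l_def B_def)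
    next
      case False
      then have "(\<Sum>i\<in>UNIV. w i * of_real (A $ i $ j)) = 0"
        using closed by (intro sum.neutral) (auto simp: w_def)
      then show ?thesis using False by (simp add: w_def)
    qed
  qed (simp add: w_def)
qed

section \<open>Fast convergence forces a linear relation\<close>

lemma geometric_ratio_tendsto_0:
  fixes r q M :: real
  assumes "0 \<le> r" "r < q"
  shows "(\<lambda>t. M * (r / q) ^ t) \<longlonglongrightarrow> 0"
  using assms by (intro tendsto_mult_right_zero LIMSEQ_realpow_zero) auto

lemma left_eigenvector_iterate:
  fixes A :: "real ^ 'n ^ 'n" and w :: "'n :: finite \<Rightarrow> complex"
  assumes "\<And>j. (\<Sum>i\<in>UNIV. w i * of_real (A $ i $ j)) = l * w j"
  shows "(\<Sum>i\<in>UNIV. w i * of_real ((((*v) A) ^^ s) y $ i)) = l ^ s * (\<Sum>i\<in>UNIV. w i * of_real (y $ i))"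
proof (induction s)
  case (Suc s)
  define z where "z = (((*v) A) ^^ s) y"
  have "(\<Sum>i\<in>UNIV. w i * of_real ((A *v z) $ i))
      = (\<Sum>i\<in>UNIV. \<Sum>j\<in>UNIV. w i * of_real (A $ i $ j) * of_real (z $ j))"
    by (simp add: matrix_vector_mult_def sum_distrib_left mult.assoc)
  also have "\<dots> = (\<Sum>j\<in>UNIV. (\<Sum>i\<in>UNIV. w i * of_real (A $ i $ j)) * of_real (z $ j))"
    by (subst sum.swap) (simp add: sum_distrib_right)
  also have "\<dots> = l * (\<Sum>j\<in>UNIV. w j * of_real (z $ j))"
    by (simp add: assms sum_distrib_left mult.assoc)
  finally show ?case using Suc by (simp add: z_def)
qed simp

text \<open>
  Along the orbit the value of \<open>w\<close> is \<open>l ^ s * K\<close>, where \<open>K\<close> is its value at \<open>y\<close>. Since the entries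
  of \<open>w\<close> sum to \<open>0\<close>, the limit \<open>c\<close> may be subtracted, so this value is \<open>O(r ^ s)\<close>; as \<open>r < cmod l\<close>,
  only \<open>K = 0\<close> is possible.
\<close>

lemma fast_decay_annihilates:
  fixes A :: "real ^ 'n ^ 'n" and w :: "'n :: finite \<Rightarrow> complex"
  assumes eig: "\<And>j. (\<Sum>i\<in>UNIV. w i * of_real (A $ i $ j)) = l * w j"
    and sum0: "(\<Sum>i\<in>UNIV. w i) = 0" and supp: "\<And>i. i \<notin> C \<Longrightarrow> w i = 0"
    and decay: "\<And>s i. i \<in> C \<Longrightarrow> \<bar>(((*v) A) ^^ s) y $ i - c\<bar> \<le> M * r ^ s"
    and r: "0 \<le> r" "r < cmod l"
  shows "(\<Sum>i\<in>UNIV. w i * of_real (y $ i)) = 0" (is "?K = 0")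
proof -
  define N where "N = (\<Sum>i\<in>UNIV. cmod (w i)) * M"
  have l: "cmod l > 0" using r by linarith
  have le: "cmod ?K \<le> N * (r / cmod l) ^ s" for s
  proof -
    have "l ^ s * ?K = (\<Sum>i\<in>UNIV. w i * of_real ((((*v) A) ^^ s) y $ i)) - (\<Sum>i\<in>UNIV. w i) * of_real c"
      using left_eigenvector_iterate[OF eig] sum0 by simp
    also have "\<dots> = (\<Sum>i\<in>UNIV. w i * of_real ((((*v) A) ^^ s) y $ i - c))"
      by (simp add: sum_distrib_right sum_subtractf right_diff_distrib)
    finally have "cmod l ^ s * cmod ?K = cmod (\<Sum>i\<in>UNIV. w i * of_real ((((*v) A) ^^ s) y $ i - c))"
      by (metis norm_mult norm_power)
    also have "\<dots> \<le> (\<Sum>i\<in>UNIV. cmod (w i) * (M * r ^ s))"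
    proof (rule sum_norm_le)
      fix i
      show "cmod (w i * of_real ((((*v) A) ^^ s) y $ i - c)) \<le> cmod (w i) * (M * r ^ s)"
        using decay[of i s] supp[of i]
        by (cases "i \<in> C") (auto simp: norm_mult simp flip: of_real_diff intro!: mult_left_mono)
    qed
    also have "\<dots> = N * r ^ s" by (simp add: N_def sum_distrib_right mult.assoc)
    finally show ?thesis using l by (simp add: power_divide field_simps)
  qed
  have "(\<lambda>s. N * (r / cmod l) ^ s) \<longlonglongrightarrow> 0"
    using r by (rule geometric_ratio_tendsto_0)
  then have "cmod ?K \<le> 0" by (rule LIMSEQ_le_const) (use le in blast)
  then show ?thesis by simp
qed

text \<open>
  The eigenvector is complex, but its real and imaginary parts both annihilate \<open>y\<close>, and one of
  them is nonzero. The vector \<open>u\<close> is chosen before \<open>y\<close>, \<open>c\<close>, \<open>M\<close> and \<open>r\<close>: a single hyperplane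
  serves all orbits that converge faster than \<open>\<rho>\<close>.
\<close>

lemma slow_community_hyperplane:
  fixes A :: "real ^ 'n ^ 'n" and C :: "('n :: finite) set"
  assumes "\<And>i j. 0 \<le> A $ i $ j" and "\<And>i. (\<Sum>j\<in>UNIV. A $ i $ j) = 1"
    and "\<And>i j. i \<in> C \<Longrightarrow> j \<notin> C \<Longrightarrow> A $ i $ j = 0"
    and "card C \<ge> 2"
    and slow: "\<rho> \<le> cmod (eigenvalue_nr 2 (principal_submatrix A C))"
  shows "\<exists>u. u \<noteq> 0 \<and> (\<forall>y c M r. 0 \<le> r \<longrightarrow> r < \<rho> \<longrightarrow>
           (\<forall>s. \<forall>i\<in>C. \<bar>(((*v) A) ^^ s) y $ i - c\<bar> \<le> M * r ^ s) \<longrightarrow> u \<bullet> y = 0)"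
proof -
  obtain w :: "'n \<Rightarrow> complex" where w: "\<exists>i. w i \<noteq> 0" "\<And>i. i \<notin> C \<Longrightarrow> w i = 0" "(\<Sum>i\<in>UNIV. w i) = 0"
    "\<And>j. (\<Sum>i\<in>UNIV. w i * of_real (A $ i $ j))
           = eigenvalue_nr 2 (principal_submatrix A C) * w j"
    using second_eigenvalue_left_eigenvector[OF assms(1-4)] by blast
  define a b :: "real ^ 'n" where "a = (\<chi> i. Re (w i))" and "b = (\<chi> i. Im (w i))"
  have ab: "a \<bullet> y = 0 \<and> b \<bullet> y = 0"
    if "0 \<le> r" "r < \<rho>" "\<forall>s. \<forall>i\<in>C. \<bar>(((*v) A) ^^ s) y $ i - c\<bar> \<le> M * r ^ s" for y c M r
  proof -
    have "(\<Sum>i\<in>UNIV. w i * of_real (y $ i)) = 0"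
      using that slow by (intro fast_decay_annihilates[OF w(4,3,2)]) auto
    then have "Re (\<Sum>i\<in>UNIV. w i * of_real (y $ i)) = 0" "Im (\<Sum>i\<in>UNIV. w i * of_real (y $ i)) = 0"
      by simp_all
    then show ?thesis by (simp add: inner_vec_def a_def b_def)
  qed
  obtain i where "w i \<noteq> 0" using w(1) by blast
  then have "a $ i \<noteq> 0 \<or> b $ i \<noteq> 0" by (simp add: a_def b_def complex_eq_iff)
  then have "a \<noteq> 0 \<or> b \<noteq> 0" by auto
  then show ?thesis using ab by blast
qed

section \<open>Fast trajectories eventually follow the graph of communities\<close>

lemma interaction_edges_spanning:
  "sym E \<Longrightarrow> interaction_edges E R \<rho> t y \<in> spanning_subgraphs E"
  by (auto simp: spanning_subgraphs_def interaction_edges_def sym_def abs_minus_commute)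

lemma community_edges_spanning:
  "sym E \<Longrightarrow> community_edges P E R \<rho> x0 \<in> spanning_subgraphs E"
  by (auto simp: spanning_subgraphs_def community_edges_def asymptotic_agreement_def sym_def)

text \<open>
  The rate in the definition of fast convergence may be negative. At \<open>t = 1\<close> this forces \<open>M = 0\<close>,
  and then the rate can be replaced by \<open>0\<close>.
\<close>

lemma fast_convergenceE:
  assumes "fast_convergence P E R \<rho> x0" "0 < \<rho>"
  obtains r M where "0 \<le> r" "r < \<rho>" "0 \<le> M"
    "\<And>t i. \<bar>opinions P E R \<rho> x0 t $ i - limit_opinion P E R \<rho> x0 i\<bar> \<le> M * r ^ t"
proof -
  obtain r M where r: "r < \<rho>" "0 \<le> M"
    "\<And>t i. \<bar>opinions P E R \<rho> x0 t $ i - limit_opinion P E R \<rho> x0 i\<bar> \<le> M * r ^ t"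
    using assms(1) unfolding fast_convergence_def by blast
  show thesis
  proof (cases "0 \<le> r")
    case True
    then show thesis using that r by blast
  next
    case False
    have "0 \<le> M * r" using r(3)[of 1] abs_ge_zero order_trans by (metis power_one_right)
    then have "M = 0" using False r(2) by (simp add: zero_le_mult_iff)
    then show thesis using that[of 0 0] r(3) assms(2) by simp
  qed
qed

text \<open>
  Opinions with the same limit differ by at most \<open>2 * M * r ^ t\<close>, which eventually drops below
  \<open>R * \<rho> ^ t\<close> because \<open>r < \<rho>\<close>. Opinions with different limits stay apart while \<open>R * \<rho> ^ t\<close>
  tends to \<open>0\<close>.
\<close>

lemma eventually_community_edges:
  fixes x0 :: "real ^ ('n :: finite)"
  assumes R: "R > 0" and \<rho>: "0 < \<rho>" "\<rho> < 1"
    and r: "0 \<le> r" "r < \<rho>"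
    and bound: "\<And>t i. \<bar>opinions P E R \<rho> x0 t $ i - limit_opinion P E R \<rho> x0 i\<bar> \<le> M * r ^ t"
  shows "\<forall>\<^sub>F t in sequentially.
    interaction_edges E R \<rho> t (opinions P E R \<rho> x0 t) = community_edges P E R \<rho> x0"
proof -
  let ?x = "opinions P E R \<rho> x0" and ?l = "limit_opinion P E R \<rho> x0"
  have lim: "(\<lambda>t. ?x t $ i) \<longlonglongrightarrow> ?l i" for i
  proof -
    have null: "(\<lambda>t. M * r ^ t) \<longlonglongrightarrow> 0"
      using geometric_ratio_tendsto_0[of r 1 M] r \<rho> by simp
    have "\<forall>\<^sub>F t in sequentially. norm (?x t $ i - ?l i) \<le> M * r ^ t"
      unfolding real_norm_def by (intro always_eventually allI bound)
    then have "(\<lambda>t. ?x t $ i - ?l i) \<longlonglongrightarrow> 0"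
      using null by (rule Lim_null_comparison)
    then show ?thesis by (simp add: LIM_zero_iff)
  qed
  have edge: "\<forall>\<^sub>F t in sequentially. \<bar>?x t $ i - ?x t $ j\<bar> \<le> R * \<rho> ^ t \<longleftrightarrow> ?l i = ?l j" for i j
  proof (cases "?l i = ?l j")
    case True
    have "(\<lambda>t. 2 * M * (r / \<rho>) ^ t) \<longlonglongrightarrow> 0"
      using r by (rule geometric_ratio_tendsto_0)
    then have "\<forall>\<^sub>F t in sequentially. 2 * M * (r / \<rho>) ^ t < R"
      using R by (rule order_tendstoD(2))
    then show ?thesis
    proof eventually_elim
      case (elim t)
      have "\<bar>?x t $ i - ?x t $ j\<bar> \<le> 2 * M * r ^ t"
        using bound[of t i] bound[of t j] True by linarith
      also have "\<dots> \<le> R * \<rho> ^ t"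
        using elim \<rho> by (simp add: power_divide field_simps)
      finally show ?case using True by simp
    qed
  next
    case False
    have "(\<lambda>t. \<bar>?x t $ i - ?x t $ j\<bar> - R * \<rho> ^ t) \<longlonglongrightarrow> \<bar>?l i - ?l j\<bar> - 0"
      using geometric_ratio_tendsto_0[of \<rho> 1 R] \<rho>
      by (intro tendsto_diff tendsto_rabs lim) simp_all
    then have "\<forall>\<^sub>F t in sequentially. 0 < \<bar>?x t $ i - ?x t $ j\<bar> - R * \<rho> ^ t"
      by (rule order_tendstoD(1)) (use False in simp)
    then show ?thesis by eventually_elim (use False in auto)
  qed
  have "\<forall>\<^sub>F t in sequentially. \<forall>i j. \<bar>?x t $ i - ?x t $ j\<bar> \<le> R * \<rho> ^ t \<longleftrightarrow> ?l i = ?l j"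
    by (intro eventually_all_finite edge)
  then show ?thesis
    by eventually_elim
      (auto simp: interaction_edges_def community_edges_def asymptotic_agreement_def)
qed

section \<open>Countably many hyperplanes\<close>

text \<open>
  The list is the history of interaction graphs, most recent first. Indexing the products by
  lists of graphs makes it evident that only countably many matrices occur.
\<close>

primrec transition_product :: "('n rel \<Rightarrow> real ^ 'n ^ 'n) \<Rightarrow> 'n rel list \<Rightarrow> real ^ 'n ^ ('n :: finite)" where
  "transition_product P [] = Finite_Cartesian_Product.mat 1"
| "transition_product P (G # Gs) = P G ** transition_product P Gs"

lemma invertible_transition_product:
  "(\<And>G. G \<in> set Gs \<Longrightarrow> invertible (P G)) \<Longrightarrow> invertible (transition_product P Gs)"
proof (induction Gs)
  case Nil
  show ?case unfolding invertible_def by (auto intro: exI[of _ "Finite_Cartesian_Product.mat 1"])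
next
  case (Cons G Gs)
  then show ?case by (simp add: invertible_mult)
qed

lemma opinions_transition_product:
  assumes "sym E"
  shows "\<exists>Gs. set Gs \<subseteq> spanning_subgraphs E \<and> opinions P E R \<rho> x0 t = transition_product P Gs *v x0"
proof (induction t)
  case 0
  show ?case by (intro exI[of _ "[]"]) (simp add: matrix_vector_mul_lid)
next
  case (Suc t)
  then obtain Gs where Gs: "set Gs \<subseteq> spanning_subgraphs E"
    "opinions P E R \<rho> x0 t = transition_product P Gs *v x0" by blast
  let ?G = "interaction_edges E R \<rho> t (opinions P E R \<rho> x0 t)"
  have "opinions P E R \<rho> x0 (Suc t) = transition_product P (?G # Gs) *v x0"
    by (simp add: Gs(2) matrix_vector_mul_assoc)
  moreover have "set (?G # Gs) \<subseteq> spanning_subgraphs E"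
    using Gs(1) interaction_edges_spanning[OF assms] by auto
  ultimately show ?case by blast
qed

text \<open>
  The exceptional set is the hyperplane orthogonal to the adjoint image of \<open>u\<close>, and this image is
  nonzero because \<open>Q\<close> is surjective.
\<close>

lemma AE_not_orthogonal:
  fixes Q :: "real ^ 'n ^ 'n" and u :: "real ^ ('n :: finite)"
  assumes "invertible Q" "u \<noteq> 0"
  shows "AE x in lebesgue. u \<bullet> (Q *v x) \<noteq> 0"
proof -
  have adj: "u \<bullet> (Q *v x) = (transpose Q *v u) \<bullet> x" for x
    by (simp add: dot_lmul_matrix transpose_matrix_vector)
  obtain Q' where "Q ** Q' = Finite_Cartesian_Product.mat 1"
    using assms(1) unfolding invertible_def by blast
  then have "(transpose Q *v u) \<bullet> (Q' *v u) = u \<bullet> u"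
    unfolding adj[symmetric] by (simp add: matrix_vector_mul_assoc)
  then have "transpose Q *v u \<noteq> 0" using assms(2) by auto
  then have "negligible {x. (transpose Q *v u) \<bullet> x = 0}" by (intro negligible_hyperplane) simp
  then have "{x. (transpose Q *v u) \<bullet> x = 0} \<in> null_sets lebesgue"
    by (simp add: negligible_iff_null_sets)
  from AE_not_in[OF this] show ?thesis
    by eventually_elim (simp add: adj)
qed

theorem theorem3:
  fixes E :: "('n :: finite) rel"
    and R \<rho> :: real
    and P :: "'n rel \<Rightarrow> real ^ 'n ^ 'n"
  assumes "sym E" and "irrefl E"
    and "R > 0" and "0 < \<rho>" and "\<rho> < 1"
    and "\<And>E' i j. E' \<in> spanning_subgraphs E \<Longrightarrow> P E' $ i $ j \<in> {0..1}"
    and "\<And>E' i. E' \<in> spanning_subgraphs E \<Longrightarrow> (\<Sum>j\<in>UNIV. P E' $ i $ j) = 1"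
    and "\<And>E' i j. E' \<in> spanning_subgraphs E \<Longrightarrow>
           P E' $ i $ j \<noteq> 0 \<longleftrightarrow> j = i \<or> (i, j) \<in> E'"
    and "\<And>E'. E' \<in> spanning_subgraphs E \<Longrightarrow> invertible (P E')"
  shows "AE x0 in (lebesgue :: (real ^ 'n) measure).
           fast_convergence P E R \<rho> x0 \<longrightarrow>
           (\<forall>C \<in> communities P E R \<rho> x0. card C \<ge> 2 \<longrightarrow>
              cmod (eigenvalue_nr 2 (principal_submatrix (P (community_edges P E R \<rho> x0)) C)) < \<rho>)"
proof -
  \<comment> \<open>The pairs to be excluded are described without reference to \<open>x0\<close>, so that the countable
    union below ranges over fixed data.\<close>
  define slow where "slow G C \<longleftrightarrow> G \<in> spanning_subgraphs E \<and> card C \<ge> 2 \<and>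
      (\<forall>(i, j)\<in>G. i \<in> C \<longrightarrow> j \<in> C) \<and>
      \<rho> \<le> cmod (eigenvalue_nr 2 (principal_submatrix (P G) C))" for G C
  have "\<exists>u. slow G C \<longrightarrow> u \<noteq> 0 \<and> (\<forall>y c M r. 0 \<le> r \<longrightarrow> r < \<rho> \<longrightarrow>
           (\<forall>s. \<forall>i\<in>C. \<bar>(((*v) (P G)) ^^ s) y $ i - c\<bar> \<le> M * r ^ s) \<longrightarrow> u \<bullet> y = 0)" for G C
  proof (cases "slow G C")
    case True
    then have G: "G \<in> spanning_subgraphs E" and closed: "\<And>i j. (i, j) \<in> G \<Longrightarrow> i \<in> C \<Longrightarrow> j \<in> C"
      by (auto simp: slow_def)
    have "P G $ i $ j = 0" if "i \<in> C" "j \<notin> C" for i j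
      using assms(8)[OF G, of i j] closed that by auto
    then show ?thesis
      using True assms(6,7)[OF G] slow_community_hyperplane[of "P G" C \<rho>]
      by (auto simp: slow_def)
  qed simp
  then obtain u where u: "\<And>G C. slow G C \<Longrightarrow> u G C \<noteq> 0"
    "\<And>G C y c M r. slow G C \<Longrightarrow> 0 \<le> r \<Longrightarrow> r < \<rho> \<Longrightarrow>
       (\<And>s i. i \<in> C \<Longrightarrow> \<bar>(((*v) (P G)) ^^ s) y $ i - c\<bar> \<le> M * r ^ s) \<Longrightarrow> u G C \<bullet> y = 0"
    by metis
  have "AE x0 in lebesgue. \<forall>Gs G C. set Gs \<subseteq> spanning_subgraphs E \<and> slow G C \<longrightarrow>
      u G C \<bullet> (transition_product P Gs *v x0) \<noteq> 0"
    unfolding AE_all_countable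
  proof (intro allI)
    fix Gs :: "'n rel list" and G :: "'n rel" and C :: "'n set"
    show "AE x0 in lebesgue. set Gs \<subseteq> spanning_subgraphs E \<and> slow G C \<longrightarrow>
      u G C \<bullet> (transition_product P Gs *v x0) \<noteq> 0"
    proof (cases "set Gs \<subseteq> spanning_subgraphs E \<and> slow G C")
      case True
      then have "invertible (transition_product P Gs)"
        using assms(9) by (intro invertible_transition_product) auto
      from AE_not_orthogonal[OF this u(1)] True show ?thesis by simp
    qed auto
  qed
  then show ?thesis
  proof eventually_elim
    case (elim x0)
    show ?case
    proof (intro impI ballI, rule ccontr)
      fix C
      assume fast: "fast_convergence P E R \<rho> x0" and C: "C \<in> communities P E R \<rho> x0" "2 \<le> card C"
      let ?x = "opinions P E R \<rho> x0" and ?l = "limit_opinion P E R \<rho> x0"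
        and ?G = "community_edges P E R \<rho> x0"
      assume "\<not> cmod (eigenvalue_nr 2 (principal_submatrix (P ?G) C)) < \<rho>"
      moreover obtain k where k: "C = {i. ?l k = ?l i}"
        using C(1) by (auto simp: communities_def asymptotic_agreement_def quotient_def Image_def)
      ultimately have slow: "slow ?G C"
        using C(2) community_edges_spanning[OF assms(1)]
        by (auto simp: slow_def community_edges_def asymptotic_agreement_def)
      obtain r M where r: "0 \<le> r" "r < \<rho>" "0 \<le> M"
        and bound: "\<And>t i. \<bar>?x t $ i - ?l i\<bar> \<le> M * r ^ t"
        using fast_convergenceE[OF fast assms(4)] by blast
      obtain T where T: "\<And>t. t \<ge> T \<Longrightarrow> interaction_edges E R \<rho> t (?x t) = ?G"
        using eventually_community_edges[OF assms(3-5) r(1,2) bound]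
        unfolding eventually_sequentially by blast
      have iter: "?x (T + s) = (((*v) (P ?G)) ^^ s) (?x T)" for s
      proof (induction s)
        case (Suc s)
        then show ?case using T[of "T + s"] by simp
      qed simp
      have "u ?G C \<bullet> ?x T = 0"
      proof (rule u(2)[OF slow r(1,2)])
        fix s i assume "i \<in> C"
        then show "\<bar>(((*v) (P ?G)) ^^ s) (?x T) $ i - ?l k\<bar> \<le> (M * r ^ T) * r ^ s"
          using bound[of "T + s" i] k by (simp add: iter power_add mult.assoc)
      qed
      moreover obtain Gs where "set Gs \<subseteq> spanning_subgraphs E" "?x T = transition_product P Gs *v x0"
        using opinions_transition_product[OF assms(1)] by blast
      ultimately show False using elim slow by metis
    qed
  qed
qed

end
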